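(* Let $\alpha\neq 0$ and $\beta$ be real numbers, let $\epsilon>0$, and let $s\leq-\frac12$, $s_1=\frac12+2\epsilon$, $b'=-\frac12+2\epsilon$, $b=\frac12+\frac{\epsilon}{2}$. Then the bilinear estimate $$\|\partial_x(uv)\|_{X_{s_1,b'}}\leq C\,\|u\|_{X_{s,b}}\|v\|_{X_{s,b}}$$ fails; that is, there is no constant $C>0$ for which it holds for all Schwartz functions $u,v$ on $\mathbb{R}^2$.
   Context: Let $\phi(\xi)=\alpha\xi^5-\beta\xi^3$, $\sigma=\tau+\phi(\xi)$ and $\langle\cdot\rangle=(1+|\cdot|^2)^{1/2}$. The space-time Fourier transform is $\mathscr{F}u(\xi,\tau)=\frac{1}{2\pi}\int_{\mathbb{R}^2}e^{-ix\xi-it\tau}u(x,t)\,dx\,dt$. For $s,b\in\mathbb{R}$, $X_{s,b}=X_{s,b}(\mathbb{R}^2)$ is the completion of the (complex-valued) Schwartz functions on $\mathbb{R}^2$ with respect to the norm $\|u\|_{X_{s,b}}=\|\langle\xi\rangle^s\langle\sigma\rangle^b\mathscr{F}u(\xi,\tau)\|_{L^2_{\xi\tau}}$. *)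

theory Defs
  imports "HOL-Analysis.Analysis"
begin

text \<open>Points of the plane are pairs \<open>(x, t)\<close> on the physical side and \<open>(\<xi>, \<tau>)\<close> on
  the frequency side.\<close>

definition partial_x :: "(real \<times> real \<Rightarrow> complex) \<Rightarrow> real \<times> real \<Rightarrow> complex" where
  "partial_x u = (\<lambda>(x, t). vector_derivative (\<lambda>y. u (y, t)) (at x))"

definition partial_t :: "(real \<times> real \<Rightarrow> complex) \<Rightarrow> real \<times> real \<Rightarrow> complex" where
  "partial_t u = (\<lambda>(x, t). vector_derivative (\<lambda>r. u (x, r)) (at t))"

text \<open>Smoothness is expressed by total differentiability of every \<open>\<partial>\<^sub>x\<^sup>j \<partial>\<^sub>t\<^sup>k u\<close>. This is
  \<open>C\<^sup>\<infinity>\<close>: total differentiability makes all these functions continuous and, by the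
  symmetry of second derivatives, makes mixed partial derivatives independent of the order.\<close>

definition schwartz :: "(real \<times> real \<Rightarrow> complex) \<Rightarrow> bool" where
  "schwartz u \<longleftrightarrow>
     (\<forall>j k. (partial_x ^^ j) ((partial_t ^^ k) u) differentiable_on UNIV) \<and>
     (\<forall>j k m n. bounded (range (\<lambda>(x, t).
        of_real (x ^ m * t ^ n) * (partial_x ^^ j) ((partial_t ^^ k) u) (x, t))))"

definition spacetime_fourier :: "(real \<times> real \<Rightarrow> complex) \<Rightarrow> real \<times> real \<Rightarrow> complex" where
  "spacetime_fourier u = (\<lambda>(\<xi>, \<tau>).
     complex_of_real (1 / (2 * pi)) *
     (LINT (x, t)|lborel. exp (- \<i> * of_real (x * \<xi>) - \<i> * of_real (t * \<tau>)) * u (x, t)))"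

definition japanese :: "real \<Rightarrow> real" where
  "japanese y = sqrt (1 + \<bar>y\<bar>\<^sup>2)"

definition phase :: "real \<Rightarrow> real \<Rightarrow> real \<Rightarrow> real" where
  "phase \<alpha> \<beta> \<xi> = \<alpha> * \<xi> ^ 5 - \<beta> * \<xi> ^ 3"

text \<open>The \<open>X\<^sub>s\<^sub>,\<^sub>b\<close> norm of a Schwartz function. The integral converges for every Schwartz
  function, since its Fourier transform decays faster than any power; outside that class
  a divergent Bochner integral would be assigned the value 0, so the definition is meant
  for Schwartz functions only.\<close>

definition Xnorm :: "real \<Rightarrow> real \<Rightarrow> real \<Rightarrow> real \<Rightarrow> (real \<times> real \<Rightarrow> complex) \<Rightarrow> real" where
  "Xnorm \<alpha> \<beta> s b u = sqrt (LINT (\<xi>, \<tau>)|lborel.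
     (japanese \<xi> powr s * japanese (\<tau> + phase \<alpha> \<beta> \<xi>) powr b *
      norm (spacetime_fourier u (\<xi>, \<tau>)))\<^sup>2)"

end

theory Submission
  imports Defs "HOL-Probability.Characteristic_Functions"
    "HOL-Real_Asymp.Real_Asymp"
begin

text \<open>For \<open>N \<ge> 2\<close> let \<open>u\<close> and \<open>v\<close> be Gaussian wave packets whose space-time Fourier transforms
  live on boxes of size \<open>N\<^sup>-\<^sup>4 \<times> 1\<close> around \<open>(0, 0)\<close> and around the point \<open>(N, - \<phi>(N))\<close> of the
  dispersion curve; the product \<open>uv\<close> lives on such a box around \<open>(N, - \<phi>(N))\<close> as well. As \<open>\<phi>\<close> has
  slope \<open>O(N\<^sup>4)\<close> near \<open>N\<close>, the modulation \<open>\<sigma>\<close> is bounded on all three boxes, so \<open>b\<close> and \<open>b'\<close> affect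
  only constants. The squares of the norms of \<open>u\<close>, \<open>v\<close> and \<open>\<partial>\<^sub>x(uv)\<close> are comparable to \<open>N\<^sup>4\<close>,
  \<open>N\<^sup>4 N\<^bsup>2s\<^esup>\<close> and \<open>N\<^sup>4 N\<^bsup>2 + 2s\<^sub>1\<^esup>\<close>, so the estimate would bound
  \<open>N\<^bsup>2s\<^sub>1 - 2s - 2\<^esup> \<ge> N\<^bsup>4\<epsilon>\<^esup>\<close> uniformly in \<open>N\<close>.\<close>

subsection \<open>Modulated Gaussians and their Fourier transforms\<close>

text \<open>The polynomial factor makes the class closed under differentiation and under
  multiplication by monomials, so that all Schwartz seminorms can be treated at once. The packets
  themselves have \<open>p = 1\<close>.\<close>

definition pgauss :: "complex poly \<Rightarrow> real \<Rightarrow> real \<Rightarrow> real \<Rightarrow> complex" where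
  "pgauss p a k x =
     poly p (of_real x) * exp (- of_real (a * x\<^sup>2) + \<i> * of_real (k * x))"

text \<open>The polynomial factor of the derivative: the linear polynomial is the derivative i k - 2
  a x of the exponent.\<close>

definition pgauss_pderiv :: "real \<Rightarrow> real \<Rightarrow> complex poly \<Rightarrow> complex poly" where
  "pgauss_pderiv a k p = pderiv p + [:\<i> * of_real k, - 2 * of_real a:] * p"

lemma has_vector_derivative_pgauss:
  "(pgauss p a k has_vector_derivative pgauss (pgauss_pderiv a k p) a k x) (at x)"
proof -
  \<comment> \<open>The entire extension of \<open>pgauss p a k\<close>; complex differentiation
    rules apply to it, and restriction to the real axis gives the claim.\<close>
  define g where "g = (\<lambda>z. poly p z * exp (- (of_real a * z\<^sup>2) + \<i> * (of_real k * z)))"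
  have "(g has_field_derivative pgauss (pgauss_pderiv a k p) a k x) (at (of_real x))"
    unfolding g_def pgauss_def pgauss_pderiv_def
    by (auto intro!: derivative_eq_intros poly_DERIV simp: algebra_simps power2_eq_square)
  from has_vector_derivative_real_field[OF this]
  have "((\<lambda>x. g (of_real x)) has_vector_derivative pgauss (pgauss_pderiv a k p) a k x) (at x)" .
  moreover have "(\<lambda>x. g (of_real x)) = pgauss p a k"
    by (auto simp: g_def pgauss_def)
  ultimately show ?thesis by simp
qed

lemma continuous_on_pgauss [continuous_intros]: "continuous_on S (pgauss p a k)"
  by (meson continuous_at_imp_continuous_on has_vector_derivative_continuous
      has_vector_derivative_pgauss)

lemma borel_measurable_pgauss [measurable]: "pgauss p a k \<in> borel_measurable borel"
  by (intro borel_measurable_continuous_onI continuous_on_pgauss)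

lemma pgauss_mult: "pgauss p a k x * pgauss q c l x = pgauss (p * q) (a + c) (k + l) x"
  by (simp add: pgauss_def exp_add exp_diff exp_minus field_simps)

lemma norm_pgauss: "norm (pgauss p a k x) = norm (poly p (of_real x)) * exp (- (a * x\<^sup>2))"
  by (simp add: pgauss_def norm_mult)

text \<open>With m = \<open>min 1 d\<close>, m (1 + z) is at most 1 + m z, hence at most exp (m z).
  Taking z to be a square trades polynomial growth for Gaussian growth of arbitrarily small
  rate.\<close>

lemma one_plus_le_exp:
  fixes z d :: real
  assumes "z \<ge> 0" "d > 0"
  shows "1 + z \<le> exp (d * z) / min 1 d"
proof -
  have "min 1 d * (1 + z) \<le> 1 + min 1 d * z" by (auto simp: algebra_simps)
  also have "\<dots> \<le> exp (min 1 d * z)" by (rule exp_ge_add_one_self)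
  also have "\<dots> \<le> exp (d * z)" using assms by (auto intro: mult_right_mono)
  finally show ?thesis using assms by (auto simp: field_simps)
qed

text \<open>Induction along the Horner scheme with \<open>d\<close> arbitrary: one half of the rate
  pays for the new factor x, the other half for the remaining polynomial.\<close>

lemma norm_poly_le_exp:
  fixes p :: "complex poly"
  assumes "d > 0"
  shows "\<exists>C\<ge>0. \<forall>x::real. norm (poly p (of_real x)) \<le> C * exp (d * x\<^sup>2)"
  using assms
proof (induction p arbitrary: d)
  case 0
  show ?case by (intro exI[of _ 0]) auto
next
  case (pCons c p)
  from pCons.IH[of "d / 2"] pCons.prems obtain C
    where C: "C \<ge> 0" "\<And>x::real. norm (poly p (of_real x)) \<le> C * exp (d / 2 * x\<^sup>2)" by auto
  let ?m = "min 1 (d / 2)"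
  have m: "?m > 0" using pCons.prems by simp
  show ?case
  proof (intro exI[of _ "norm c + C / ?m"] conjI allI)
    show "norm c + C / ?m \<ge> 0" using C m by (intro add_nonneg_nonneg divide_nonneg_pos) auto
    fix x :: real
    have "\<bar>x\<bar> \<le> 1 + x\<^sup>2"
      using arith_geo_mean_sqrt[of "1" "x\<^sup>2"] by simp
    also have "\<dots> \<le> exp (d / 2 * x\<^sup>2) / ?m"
      using one_plus_le_exp[of "x\<^sup>2" "d / 2"] pCons.prems by simp
    finally have x: "\<bar>x\<bar> \<le> exp (d / 2 * x\<^sup>2) / ?m" .
    have "norm (poly (pCons c p) (of_real x)) \<le> norm c + \<bar>x\<bar> * norm (poly p (of_real x))"
      by (simp add: norm_mult order_trans[OF norm_triangle_ineq])
    also have "\<dots> \<le> norm c + (exp (d / 2 * x\<^sup>2) / ?m) * (C * exp (d / 2 * x\<^sup>2))"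
      using x C m by (intro add_left_mono mult_mono) auto
    also have "\<dots> = norm c + C / ?m * exp (d * x\<^sup>2)"
      by (simp add: field_simps flip: exp_add)
    also have "\<dots> \<le> norm c * exp (d * x\<^sup>2) + C / ?m * exp (d * x\<^sup>2)"
      using pCons.prems by (simp add: mult_le_cancel_left1)
    finally show "norm (poly (pCons c p) (of_real x)) \<le> (norm c + C / ?m) * exp (d * x\<^sup>2)"
      by (simp add: algebra_simps)
  qed
qed

text \<open>Half of the Gaussian absorbs the polynomial. Boundedness, decay at infinity and
  integrability all follow from this bound.\<close>

lemma pgauss_tail:
  assumes "a > 0"
  shows "\<exists>C\<ge>0. \<forall>x. norm (pgauss p a k x) \<le> C * exp (- (a / 2 * x\<^sup>2))"
proof -
  obtain C where C: "C \<ge> 0" "\<And>x::real. norm (poly p (of_real x)) \<le> C * exp (a / 2 * x\<^sup>2)"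
    using norm_poly_le_exp[of "a / 2" p] assms by auto
  have "norm (pgauss p a k x) \<le> C * exp (- (a / 2 * x\<^sup>2))" for x
  proof -
    have "norm (pgauss p a k x) \<le> C * exp (a / 2 * x\<^sup>2) * exp (- (a * x\<^sup>2))"
      unfolding norm_pgauss by (intro mult_right_mono C) auto
    also have "\<dots> = C * exp (- (a / 2 * x\<^sup>2))"
      by (simp add: mult.assoc flip: exp_add)
    finally show ?thesis .
  qed
  with C show ?thesis by blast
qed

lemma bounded_pgauss:
  assumes "a > 0"
  shows "bounded (range (pgauss p a k))"
proof -
  obtain C where C: "C \<ge> 0" "\<And>x. norm (pgauss p a k x) \<le> C * exp (- (a / 2 * x\<^sup>2))"
    using pgauss_tail[OF assms] by blast
  have "C * exp (- (a / 2 * x\<^sup>2)) \<le> C" for x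
    using C(1) assms by (intro mult_left_le) auto
  with C(2) show ?thesis by (intro boundedI[of _ C]) (auto intro: order_trans)
qed

lemma tendsto_pgauss:
  assumes "a > 0"
  shows "(pgauss p a k \<longlongrightarrow> 0) at_top" and "(pgauss p a k \<longlongrightarrow> 0) at_bot"
proof -
  obtain C where C: "C \<ge> 0" "\<And>x. norm (pgauss p a k x) \<le> C * exp (- (a / 2 * x\<^sup>2))"
    using pgauss_tail[OF assms] by blast
  have 1: "((\<lambda>x. C * exp (- (a / 2 * x\<^sup>2))) \<longlongrightarrow> 0) at_top"
    and 2: "((\<lambda>x. C * exp (- (a / 2 * x\<^sup>2))) \<longlongrightarrow> 0) at_bot"
    using assms by real_asymp+
  show "(pgauss p a k \<longlongrightarrow> 0) at_top" "(pgauss p a k \<longlongrightarrow> 0) at_bot"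
    by (rule Lim_null_comparison[OF always_eventually 1] Lim_null_comparison[OF always_eventually 2],
        use C in auto)+
qed

lemma integrable_gaussian:
  fixes a :: real
  assumes "a > 0"
  shows "integrable lborel (\<lambda>x. exp (- (a * x\<^sup>2)))"
proof -
  have "integrable lborel (\<lambda>x. sqrt (2 * pi) * std_normal_density (0 + sqrt (2 * a) * x))"
    using assms
    by (intro integrable_mult_right lborel_integrable_real_affine integrable_normal_density) auto
  thus ?thesis using assms by (simp add: std_normal_density_def power_mult_distrib)
qed

lemma integrable_pgauss:
  assumes "a > 0"
  shows "integrable lborel (pgauss p a k)"
proof -
  obtain C where C: "C \<ge> 0" "\<And>x. norm (pgauss p a k x) \<le> C * exp (- (a / 2 * x\<^sup>2))"
    using pgauss_tail[OF assms] by blast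
  show ?thesis
    using C assms
    by (intro Bochner_Integration.integrable_bound
          [OF integrable_mult_right[OF integrable_gaussian[of "a / 2"], of C]]) auto
qed

text \<open>This is the characteristic function of the standard normal distribution at k / r with r
  = sqrt (2 a): substituting r x turns the density into a multiple of exp (- a x^2) and the
  frequency k / r into k.\<close>

lemma integral_pgauss_1:
  assumes "a > 0"
  shows "(LINT x|lborel. pgauss 1 a k x) = of_real (sqrt (pi / a) * exp (- (k\<^sup>2 / (4 * a))))"
proof -
  define r where "r = sqrt (2 * a)"
  have r: "r > 0" "r\<^sup>2 = 2 * a" using assms by (auto simp: r_def)
  have "of_real (exp (- ((k / r)\<^sup>2) / 2)) = char std_normal_distribution (k / r)"
    by (simp add: char_std_normal_distribution)
  also have "\<dots> = (LINT x|lborel. std_normal_density x *\<^sub>R exp (\<i> * of_real (k / r * x)))"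
    unfolding char_def by (subst integral_density) auto
  also have "\<dots> = r *\<^sub>R (LINT x|lborel. std_normal_density (0 + r * x) *\<^sub>R
      exp (\<i> * of_real (k / r * (0 + r * x))))"
    using r by (subst lborel_integral_real_affine[of r _ 0]) auto
  also have "\<dots> = r *\<^sub>R (LINT x|lborel. of_real (1 / sqrt (2 * pi)) * pgauss 1 a k x)"
    using r by (intro arg_cong[where f = "(*\<^sub>R) r"] Bochner_Integration.integral_cong refl)
      (simp add: std_normal_density_def pgauss_def scaleR_conv_of_real exp_add
        exp_diff exp_minus field_simps flip: exp_of_real)
  also have "\<dots> = of_real (r / sqrt (2 * pi)) * (LINT x|lborel. pgauss 1 a k x)"
    by (simp add: scaleR_conv_of_real)
  finally have "of_real (sqrt (2 * pi) / r) * of_real (exp (- ((k / r)\<^sup>2) / 2)) =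
      (LINT x|lborel. pgauss 1 a k x)"
    using r by (simp add: field_simps flip: of_real_mult)
  moreover have "sqrt (2 * pi) / r = sqrt (pi / a)"
    using assms by (simp add: r_def flip: real_sqrt_divide)
  moreover have "- ((k / r)\<^sup>2) / 2 = - (k\<^sup>2 / (4 * a))"
    using r by (simp add: power_divide)
  ultimately show ?thesis by (metis of_real_mult)
qed

lemma modulate_pgauss: "exp (- \<i> * of_real (x * \<xi>)) * pgauss p a k x = pgauss p a (k - \<xi>) x"
  by (simp add: pgauss_def algebra_simps flip: exp_add)

text \<open>The integrand is the derivative of \<open>pgauss p a k\<close>, which vanishes at both
  ends of the line.\<close>

lemma integral_pgauss_pderiv:
  assumes "a > 0"
  shows "(LINT x|lborel. pgauss (pgauss_pderiv a k p) a k x) = 0"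
proof -
  have "(LBINT x=-\<infinity>..\<infinity>. pgauss (pgauss_pderiv a k p) a k x) = 0 - 0"
  proof (rule interval_integral_FTC_integrable[where F = "pgauss p a k"])
    show "set_integrable lborel (einterval (- \<infinity>) \<infinity>) (pgauss (pgauss_pderiv a k p) a k)"
      using integrable_pgauss[OF assms] by (simp add: set_integrable_def)
    show "((pgauss p a k \<circ> real_of_ereal) \<longlongrightarrow> 0) (at_right (- \<infinity>))"
      "((pgauss p a k \<circ> real_of_ereal) \<longlongrightarrow> 0) (at_left \<infinity>)"
      using tendsto_pgauss[OF assms] by (simp_all add: ereal_tendsto_simps)
  qed (use continuous_on_pgauss[of UNIV] in
      \<open>auto simp: continuous_on_eq_continuous_at intro: has_vector_derivative_pgauss\<close>)
  thus ?thesis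
    by (simp add: interval_lebesgue_integral_def set_lebesgue_integral_def)
qed

text \<open>Integration by parts. The exponential shifts the frequency k to k - \<xi>; the
  derivative polynomials formed with k and with k - \<xi> differ by i \<xi> p, and the part formed
  with k - \<xi> is an exact derivative with integral 0.\<close>

lemma fourier_pgauss_pderiv:
  assumes "a > 0"
  shows "(LINT x|lborel. exp (- \<i> * of_real (x * \<xi>)) * pgauss (pgauss_pderiv a k p) a k x) =
    \<i> * of_real \<xi> * (LINT x|lborel. exp (- \<i> * of_real (x * \<xi>)) * pgauss p a k x)"
proof -
  have *: "pgauss (pgauss_pderiv a k p) a (k - \<xi>) x =
     pgauss (pgauss_pderiv a (k - \<xi>) p) a (k - \<xi>) x + \<i> * of_real \<xi> * pgauss p a (k - \<xi>) x" for x
    by (simp add: pgauss_def pgauss_pderiv_def algebra_simps)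
  show ?thesis
    unfolding modulate_pgauss *
    using integrable_pgauss[OF assms] integral_pgauss_pderiv[OF assms]
    by (subst Bochner_Integration.integral_add) auto
qed

section \<open>Tensor products: space-time Fourier transform and the Schwartz property\<close>

lemma integrable_tensor:
  fixes f g :: "real \<Rightarrow> 'a :: {real_normed_field, banach, second_countable_topology}"
  assumes "integrable lborel f" "integrable lborel g"
  shows "integrable lborel (\<lambda>(x, y). f x * g y)"
    and "(LINT (x, y)|lborel. f x * g y) = (LINT x|lborel. f x) * (LINT y|lborel. g y)"
proof -
  have [measurable]: "f \<in> borel_measurable borel" "g \<in> borel_measurable borel"
    using assms[THEN borel_measurable_integrable] by auto
  have 1: "integrable (lborel \<Otimes>\<^sub>M lborel) (\<lambda>(x, y). f x * g y)"
    using assms by (intro lborel_pair.Fubini_integrable) (auto simp: norm_mult)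
  thus "integrable lborel (\<lambda>(x, y). f x * g y)" by (simp add: lborel_prod)
  show "(LINT (x, y)|lborel. f x * g y) = (LINT x|lborel. f x) * (LINT y|lborel. g y)"
    using lborel_pair.integral_fst'[OF 1] by (simp add: lborel_prod)
qed

lemma spacetime_fourier_tensor:
  assumes "integrable lborel f" "integrable lborel g"
  shows "spacetime_fourier (\<lambda>(x, t). f x * g t) (\<xi>, \<tau>) = of_real (1 / (2 * pi)) *
    ((LINT x|lborel. exp (- \<i> * of_real (x * \<xi>)) * f x) *
     (LINT t|lborel. exp (- \<i> * of_real (t * \<tau>)) * g t))"
proof -
  have *: "integrable lborel (\<lambda>x. exp (- \<i> * of_real (x * \<xi>)) * f x)"
    if "integrable lborel f" for f :: "real \<Rightarrow> complex" and \<xi>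
    using that borel_measurable_integrable[OF that]
    by (intro Bochner_Integration.integrable_bound[OF that]) (auto simp: norm_mult)
  have "(LINT (x, t)|lborel. exp (- \<i> * of_real (x * \<xi>) - \<i> * of_real (t * \<tau>)) *
      (case (x, t) of (x, t) \<Rightarrow> f x * g t)) =
    (LINT (x, t)|lborel. (exp (- \<i> * of_real (x * \<xi>)) * f x) * (exp (- \<i> * of_real (t * \<tau>)) * g t))"
    by (intro Bochner_Integration.integral_cong)
      (auto simp: exp_diff exp_minus field_simps)
  thus ?thesis
    unfolding spacetime_fourier_def
    using integrable_tensor(2)[OF *[OF assms(1)] *[OF assms(2)]] by simp
qed

lemma partial_x_pgauss:
  "partial_x (\<lambda>(x, t). pgauss p a k x * g t) = (\<lambda>(x, t). pgauss (pgauss_pderiv a k p) a k x * g t)"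
  unfolding partial_x_def
  by (auto intro!: vector_derivative_at has_vector_derivative_mult_left has_vector_derivative_pgauss)

lemma partial_t_pgauss:
  "partial_t (\<lambda>(x, t). f x * pgauss q c l t) = (\<lambda>(x, t). f x * pgauss (pgauss_pderiv c l q) c l t)"
  unfolding partial_t_def
  by (auto intro!: vector_derivative_at has_vector_derivative_mult_right has_vector_derivative_pgauss)

text \<open>Partial derivatives and monomial factors act on one tensor factor each and only change
  its polynomial, so every seminorm is bounded by a product of two suprema of functions of the form
  \<open>pgauss\<close>.\<close>

lemma schwartz_pgauss:
  assumes "a > 0" "c > 0"
  shows "schwartz (\<lambda>(x, t). pgauss p a k x * pgauss q c l t)"
proof -
  have t: "(partial_t ^^ n) (\<lambda>(x, t). f x * pgauss q c l t) =
      (\<lambda>(x, t). f x * pgauss ((pgauss_pderiv c l ^^ n) q) c l t)" for n f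
    by (induction n) (auto simp: partial_t_pgauss)
  have x: "(partial_x ^^ n) (\<lambda>(x, t). pgauss p a k x * g t) =
      (\<lambda>(x, t). pgauss ((pgauss_pderiv a k ^^ n) p) a k x * g t)" for n g
    by (induction n) (auto simp: partial_x_pgauss)
  have diff: "(\<lambda>(x, t). pgauss p a k x * pgauss q c l t) differentiable_on UNIV" for p q
  proof -
    have *: "pgauss p a k differentiable at x" for p a k x
      using has_vector_derivative_pgauss differentiableI_vector by blast
    have "(pgauss p a k \<circ> fst) differentiable at z" "(pgauss q c l \<circ> snd) differentiable at z"
      for z :: "real \<times> real"
      by (intro differentiable_chain_at * bounded_linear_imp_differentiable
          bounded_linear_fst bounded_linear_snd)+
    thus ?thesis
      by (auto simp: differentiable_on_def case_prod_unfold o_def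
          intro!: differentiable_mult differentiable_at_withinI)
  qed
  have bdd: "bounded (range (\<lambda>(x, t). of_real (x ^ m * t ^ n) * (pgauss p a k x * pgauss q c l t)))"
    for p q m n
  proof -
    have *: "\<exists>B. \<forall>x. norm (of_real (x ^ m) * pgauss p a k x) \<le> B" if "a > 0" for p a k m
    proof -
      have "of_real (x ^ m) * pgauss p a k x = pgauss (monom 1 m * p) a k x" for x
        by (simp add: pgauss_def poly_monom)
      thus ?thesis using bounded_pgauss[OF that, of "monom 1 m * p" k]
        by (auto simp: bounded_iff)
    qed
    obtain A B where
      A: "\<And>x. norm (of_real (x ^ m) * pgauss p a k x) \<le> A" and
      B: "\<And>t. norm (of_real (t ^ n) * pgauss q c l t) \<le> B"
      using *[OF assms(1)] *[OF assms(2)] by metis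
    have "norm (of_real (x ^ m * t ^ n) * (pgauss p a k x * pgauss q c l t)) \<le> A * B" for x t
    proof -
      have "norm (of_real (x ^ m * t ^ n) * (pgauss p a k x * pgauss q c l t)) =
        norm (of_real (x ^ m) * pgauss p a k x) * norm (of_real (t ^ n) * pgauss q c l t)"
        by (simp add: norm_mult)
      also have "\<dots> \<le> A * B"
        using A B order_trans[OF norm_ge_zero A] by (intro mult_mono) auto
      finally show ?thesis .
    qed
    thus ?thesis by (intro boundedI[of _ "A * B"]) auto
  qed
  show ?thesis
    unfolding schwartz_def t x using diff bdd by (auto simp: case_prod_unfold)
qed

subsection \<open>Weights near the dispersion curve\<close>

lemma japanese_power2: "(japanese y)\<^sup>2 = 1 + y\<^sup>2"
  by (simp add: japanese_def)

lemma japanese_ge_1: "japanese y \<ge> 1"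
  by (simp add: japanese_def)

lemma japanese_pos: "japanese y > 0"
  using japanese_ge_1[of y] by linarith

lemma abs_le_japanese: "\<bar>y\<bar> \<le> japanese y"
  by (simp add: japanese_def real_le_rsqrt)

lemma japanese_mono: "\<bar>x\<bar> \<le> \<bar>y\<bar> \<Longrightarrow> japanese x \<le> japanese y"
  unfolding japanese_def by (simp add: abs_le_square_iff)

lemma japanese_le: "japanese y \<le> 1 + \<bar>y\<bar>"
  unfolding japanese_def by (rule real_le_lsqrt) (auto simp: power2_eq_square algebra_simps)

text \<open>After squaring, this rests on x^2 <= 2 (y^2 + (x - y)^2), whose two sides differ by (x -
  2 y)^2.\<close>

lemma japanese_triangle: "japanese x \<le> 2 * japanese y * japanese (x - y)"
proof (rule power2_le_imp_le)
  have "x\<^sup>2 \<le> 2 * (y\<^sup>2 + (x - y)\<^sup>2)"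
    using zero_le_power2[of "x - 2 * y"] by (simp add: power2_eq_square algebra_simps)
  moreover have "0 \<le> y\<^sup>2 * (x - y)\<^sup>2" by simp
  ultimately have "1 + x\<^sup>2 \<le> 4 * ((1 + y\<^sup>2) * (1 + (x - y)\<^sup>2))"
    using zero_le_power2[of y] zero_le_power2[of "x - y"] by (simp only: distrib_left distrib_right)
  moreover have "(2 * japanese y * japanese (x - y))\<^sup>2 = 4 * ((1 + y\<^sup>2) * (1 + (x - y)\<^sup>2))"
    by (simp add: power_mult_distrib japanese_power2)
  ultimately show "(japanese x)\<^sup>2 \<le> (2 * japanese y * japanese (x - y))\<^sup>2"
    by (simp only: japanese_power2)
qed (simp add: japanese_pos less_imp_le)

text \<open>Peetre's inequality, needed for exponents of both signs. For r >= 0 it is a power of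
  \<open>japanese_triangle\<close>; for r < 0 the triangle inequality with x and y exchanged is
  raised to the power - r and the negative powers are cleared.\<close>

lemma peetre:
  "japanese x powr r \<le> 2 powr \<bar>r\<bar> * japanese y powr r * japanese (x - y) powr \<bar>r\<bar>"
proof (cases "r \<ge> 0")
  case True
  have "japanese x powr r \<le> (2 * japanese y * japanese (x - y)) powr r"
    using True japanese_triangle by (intro powr_mono2) (auto simp: japanese_pos less_imp_le)
  thus ?thesis using True by (simp add: powr_mult japanese_pos less_imp_le)
next
  case False
  have "japanese (y - x) = japanese (x - y)" by (simp add: japanese_def power2_commute)
  hence "japanese y powr (- r) \<le> (2 * japanese x * japanese (x - y)) powr (- r)"
    using False japanese_triangle[of y x] by (intro powr_mono2) (auto simp: japanese_pos less_imp_le)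
  hence "japanese y powr (- r) \<le> 2 powr (- r) * japanese x powr (- r) * japanese (x - y) powr (- r)"
    by (simp add: powr_mult japanese_pos less_imp_le)
  hence "japanese x powr r * japanese y powr r * japanese y powr (- r) \<le> japanese x powr r *
    japanese y powr r * (2 powr (- r) * japanese x powr (- r) * japanese (x - y) powr (- r))"
    by (intro mult_left_mono) auto
  thus ?thesis using False japanese_pos[of x] japanese_pos[of y]
    by (simp add: powr_minus field_simps)
qed

text \<open>Each term of the binomial expansion is a multiple of K^j h^i with j <= 4 i, hence
  bounded by the i-th power of |N^4 h|; this is why frequency boxes of width N^-4 keep the
  modulation bounded. The constants are 31 = 5 + 10 + 10 + 5 + 1 and 7 = 3 + 3 + 1, and the exponent
  5 is the highest power of h.\<close>

lemma abs_phase_diff_le: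
  assumes "N \<ge> 1" "\<bar>K\<bar> \<le> N"
  shows "\<bar>phase \<alpha> \<beta> (K + h) - phase \<alpha> \<beta> K\<bar> \<le>
    (31 * \<bar>\<alpha>\<bar> + 7 * \<bar>\<beta>\<bar>) * japanese (N ^ 4 * h) ^ 5"
proof -
  define J where "J = japanese (N ^ 4 * h)"
  have J: "J \<ge> 1" "\<bar>N ^ 4 * h\<bar> \<le> J" unfolding J_def by (rule japanese_ge_1 abs_le_japanese)+
  have *: "\<bar>K ^ j * h ^ i\<bar> \<le> J ^ 5" if "j \<le> 4 * i" "i \<le> 5" for i j
  proof -
    have "\<bar>K ^ j * h ^ i\<bar> = \<bar>K\<bar> ^ j * \<bar>h\<bar> ^ i" by (simp add: abs_mult power_abs)
    also have "\<dots> \<le> N ^ j * \<bar>h\<bar> ^ i"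
      using assms by (intro mult_right_mono power_mono) auto
    also have "\<dots> \<le> N ^ (4 * i) * \<bar>h\<bar> ^ i"
      using assms that by (intro mult_right_mono power_increasing) auto
    also have "\<dots> = \<bar>N ^ 4 * h\<bar> ^ i"
      using assms by (simp add: power_mult abs_mult power_mult_distrib)
    also have "\<dots> \<le> J ^ i" using J by (intro power_mono) auto
    also have "\<dots> \<le> J ^ 5" using J that by (intro power_increasing) auto
    finally show ?thesis .
  qed
  \<comment> \<open>\<open>P\<close> and \<open>Q\<close> are (K + h)^5 - K^5 and (K + h)^3 - K^3;
    the explicit powers 0 and 1 match the pattern of \<open>*\<close>.\<close>
  define P where "P = 5 * (K ^ 4 * h ^ 1) + 10 * (K ^ 3 * h ^ 2) + 10 * (K ^ 2 * h ^ 3)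
    + 5 * (K ^ 1 * h ^ 4) + K ^ 0 * h ^ 5"
  define Q where "Q = 3 * (K ^ 2 * h ^ 1) + 3 * (K ^ 1 * h ^ 2) + K ^ 0 * h ^ 3"
  have P: "\<bar>P\<bar> \<le> 31 * J ^ 5"
    using *[of 4 1] *[of 3 2] *[of 2 3] *[of 1 4] *[of 0 5] unfolding P_def by simp
  have Q: "\<bar>Q\<bar> \<le> 7 * J ^ 5"
    using *[of 2 1] *[of 1 2] *[of 0 3] unfolding Q_def by simp
  have "phase \<alpha> \<beta> (K + h) - phase \<alpha> \<beta> K = \<alpha> * P - \<beta> * Q"
    unfolding phase_def P_def Q_def by algebra
  also have "\<bar>\<dots>\<bar> \<le> \<bar>\<alpha>\<bar> * \<bar>P\<bar> + \<bar>\<beta>\<bar> * \<bar>Q\<bar>"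
    by (simp add: abs_mult order_trans[OF abs_triangle_ineq4])
  also have "\<dots> \<le> \<bar>\<alpha>\<bar> * (31 * J ^ 5) + \<bar>\<beta>\<bar> * (7 * J ^ 5)"
    using P Q by (intro add_mono mult_left_mono) auto
  finally show ?thesis by (simp add: J_def algebra_simps)
qed

text \<open>Compares the weight with its value at the centre (K, - \<phi>(K)) of a box, losing only
  powers of the rescaled distances, which a Gaussian will absorb. \<open>A\<close> and
  \<open>p\<close> are chosen before N and K. K is kept apart from N because the packet at frequency
  0 also has width N^-4.\<close>

lemma weight_upper:
  "\<exists>A>0. \<exists>p\<ge>0. \<forall>N K \<xi> \<tau>. N \<ge> 1 \<longrightarrow> \<bar>K\<bar> \<le> N \<longrightarrow>
     japanese \<xi> powr s * japanese (\<tau> + phase \<alpha> \<beta> \<xi>) powr b \<le> A * japanese K powr s *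
       (japanese (N ^ 4 * (\<xi> - K)) powr p * japanese (\<tau> + phase \<alpha> \<beta> K) powr p)"
proof -
  define C where "C = 1 + (31 * \<bar>\<alpha>\<bar> + 7 * \<bar>\<beta>\<bar>)"
  have C: "C > 0" by (simp add: C_def add_pos_nonneg)
  \<comment> \<open>Peetre in \<xi> costs \<open>\<bar>s\<bar>\<close> powers of \<open>J\<close>.
    Peetre in the modulation costs \<open>\<bar>b\<bar>\<close> powers of the phase difference,
    which is itself of order \<open>J ^ 5\<close>.\<close>
  define p where "p = \<bar>s\<bar> + 5 * \<bar>b\<bar>"
  define A where "A = 2 powr \<bar>s\<bar> * 2 powr \<bar>b\<bar> * C powr \<bar>b\<bar>"
  have "japanese \<xi> powr s * japanese (\<tau> + phase \<alpha> \<beta> \<xi>) powr b \<le> A * japanese K powr s *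
       (japanese (N ^ 4 * (\<xi> - K)) powr p * japanese (\<tau> + phase \<alpha> \<beta> K) powr p)"
    if N: "N \<ge> 1" "\<bar>K\<bar> \<le> N" for N K \<xi> \<tau>
  proof -
    define J where "J = japanese (N ^ 4 * (\<xi> - K))"
    define T where "T = japanese (\<tau> + phase \<alpha> \<beta> K)"
    define D where "D = phase \<alpha> \<beta> \<xi> - phase \<alpha> \<beta> K"
    have J: "J \<ge> 1" "T \<ge> 1" unfolding J_def T_def by (rule japanese_ge_1)+
    have "japanese (\<xi> - K) \<le> J"
      unfolding J_def using N by (intro japanese_mono) (simp add: abs_mult mult_le_cancel_right1)
    hence "japanese (\<xi> - K) powr \<bar>s\<bar> \<le> J powr \<bar>s\<bar>"
      by (intro powr_mono2) (auto simp: japanese_pos less_imp_le)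
    with peetre[of \<xi> s K] have 1: "japanese \<xi> powr s \<le> 2 powr \<bar>s\<bar> * japanese K powr s * J powr \<bar>s\<bar>"
      by (elim order_trans) (auto intro: mult_left_mono)
    have "japanese D \<le> 1 + \<bar>D\<bar>" by (rule japanese_le)
    also have "\<dots> \<le> 1 + (31 * \<bar>\<alpha>\<bar> + 7 * \<bar>\<beta>\<bar>) * J ^ 5"
      using abs_phase_diff_le[OF N, of \<alpha> \<beta> "\<xi> - K"] by (simp add: D_def J_def)
    also have "\<dots> \<le> C * J ^ 5"
      using J by (simp add: C_def algebra_simps)
    finally have "japanese D powr \<bar>b\<bar> \<le> (C * J ^ 5) powr \<bar>b\<bar>"
      by (intro powr_mono2) (auto simp: japanese_pos less_imp_le)
    also have "\<dots> = C powr \<bar>b\<bar> * J powr (5 * \<bar>b\<bar>)"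
      using J C by (simp add: powr_mult powr_powr flip: powr_numeral)
    finally have D: "japanese D powr \<bar>b\<bar> \<le> C powr \<bar>b\<bar> * J powr (5 * \<bar>b\<bar>)" .
    have "japanese (\<tau> + phase \<alpha> \<beta> \<xi>) powr b \<le> 2 powr \<bar>b\<bar> * T powr b * japanese D powr \<bar>b\<bar>"
      using peetre[of "\<tau> + phase \<alpha> \<beta> \<xi>" b "\<tau> + phase \<alpha> \<beta> K"] by (simp add: T_def D_def)
    also have "\<dots> \<le> 2 powr \<bar>b\<bar> * T powr p * (C powr \<bar>b\<bar> * J powr (5 * \<bar>b\<bar>))"
      using J D by (intro mult_mono powr_mono) (auto simp: p_def)
    finally have 2: "japanese (\<tau> + phase \<alpha> \<beta> \<xi>) powr b \<le>
        2 powr \<bar>b\<bar> * T powr p * (C powr \<bar>b\<bar> * J powr (5 * \<bar>b\<bar>))" .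
    have "japanese \<xi> powr s * japanese (\<tau> + phase \<alpha> \<beta> \<xi>) powr b \<le>
      (2 powr \<bar>s\<bar> * japanese K powr s * J powr \<bar>s\<bar>) *
      (2 powr \<bar>b\<bar> * T powr p * (C powr \<bar>b\<bar> * J powr (5 * \<bar>b\<bar>)))"
      using 1 2 by (intro mult_mono) auto
    also have "\<dots> = A * japanese K powr s * (J powr p * T powr p)"
      by (simp add: A_def p_def powr_add)
    finally show ?thesis by (simp add: J_def T_def)
  qed
  moreover have "A > 0" "p \<ge> 0" using C by (auto simp: A_def p_def)
  ultimately show ?thesis by blast
qed

text \<open>This is \<open>weight_upper\<close> for the exponents - s and - b, with the reciprocals
  cleared.\<close>

lemma weight_lower:
  "\<exists>A>0. \<exists>p\<ge>0. \<forall>N K \<xi> \<tau>. N \<ge> 1 \<longrightarrow> \<bar>K\<bar> \<le> N \<longrightarrow>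
     japanese K powr s \<le> A * (japanese (N ^ 4 * (\<xi> - K)) powr p * japanese (\<tau> + phase \<alpha> \<beta> K) powr p) *
       (japanese \<xi> powr s * japanese (\<tau> + phase \<alpha> \<beta> \<xi>) powr b)"
proof -
  obtain A p where A: "A > 0" "p \<ge> 0" and *: "\<And>N K \<xi> \<tau>. N \<ge> 1 \<Longrightarrow> \<bar>K\<bar> \<le> N \<Longrightarrow>
     japanese \<xi> powr (- s) * japanese (\<tau> + phase \<alpha> \<beta> \<xi>) powr (- b) \<le> A * japanese K powr (- s) *
       (japanese (N ^ 4 * (\<xi> - K)) powr p * japanese (\<tau> + phase \<alpha> \<beta> K) powr p)"
    using weight_upper[of "- s" \<alpha> \<beta> "- b"] by blast
  have "japanese K powr s \<le> A * (japanese (N ^ 4 * (\<xi> - K)) powr p * japanese (\<tau> + phase \<alpha> \<beta> K) powr p) *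
       (japanese \<xi> powr s * japanese (\<tau> + phase \<alpha> \<beta> \<xi>) powr b)"
    if "N \<ge> 1" "\<bar>K\<bar> \<le> N" for N K \<xi> \<tau>
    using *[OF that, of \<xi> \<tau>] japanese_pos[of \<xi>] japanese_pos[of K] japanese_pos[of "\<tau> + phase \<alpha> \<beta> \<xi>"]
    by (simp add: powr_minus field_simps)
  with A show ?thesis by blast
qed

lemma japanese_powr_le_exp:
  assumes "q \<ge> 0" "d > 0"
  shows "\<exists>B>0. \<forall>y. japanese y powr q \<le> B * exp (d * y\<^sup>2)"
proof -
  \<comment> \<open>Chosen so that \<delta> q / 2 = d q / (q + 1) <= d; the denominator q + 1 also
    covers q = 0.\<close>
  define \<delta> where "\<delta> = 2 * d / (q + 1)"
  have \<delta>: "\<delta> > 0" using assms by (simp add: \<delta>_def)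
  define m where "m = min 1 \<delta>"
  have m: "m > 0" using \<delta> by (simp add: m_def)
  have "japanese y powr q \<le> (1 / m) powr (q / 2) * exp (d * y\<^sup>2)" for y
  proof -
    have "japanese y = (1 + y\<^sup>2) powr (1 / 2)" by (simp add: japanese_def powr_half_sqrt)
    hence "japanese y powr q = (1 + y\<^sup>2) powr (q / 2)" by (simp add: powr_powr)
    also have "\<dots> \<le> (exp (\<delta> * y\<^sup>2) / m) powr (q / 2)"
      unfolding m_def using assms \<delta> by (intro powr_mono2 one_plus_le_exp) auto
    also have "\<dots> = (1 / m) powr (q / 2) * exp (\<delta> * y\<^sup>2 * (q / 2))"
      using m by (simp add: powr_divide exp_powr_real)
    also have "\<dots> \<le> (1 / m) powr (q / 2) * exp (d * y\<^sup>2)"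
    proof -
      have "\<delta> * (q / 2) \<le> d" using assms by (simp add: \<delta>_def field_simps)
      hence "\<delta> * (q / 2) * y\<^sup>2 \<le> d * y\<^sup>2" by (intro mult_right_mono) auto
      thus ?thesis by (intro mult_left_mono) (auto simp: algebra_simps)
    qed
    finally show ?thesis .
  qed
  moreover have "(1 / m) powr (q / 2) > 0" using m by simp
  ultimately show ?thesis by blast
qed

lemma integral_dilate:
  fixes f :: "real \<Rightarrow> real"
  assumes "integrable lborel f" "M > 0"
  shows "integrable lborel (\<lambda>x. f (M * (x - K)))"
    and "(LINT x|lborel. f (M * (x - K))) = (LINT x|lborel. f x) / M"
proof -
  have *: "f (M * (x - K)) = f (- M * K + M * x)" for x by (simp add: algebra_simps)
  show "integrable lborel (\<lambda>x. f (M * (x - K)))"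
    unfolding * using assms by (intro lborel_integrable_real_affine) auto
  show "(LINT x|lborel. f (M * (x - K))) = (LINT x|lborel. f x) / M"
    unfolding * using assms lborel_integral_real_affine[of M f "- M * K"] by simp
qed

section \<open>Upper and lower bounds for the norms of Gaussian packets\<close>

text \<open>The explicit formula for the modulus of the transform replaces an argument about
  measurability of a parameter integral.\<close>

lemma Xnorm_integrand_measurable:
  assumes "\<And>\<xi> \<tau>. norm (spacetime_fourier u (\<xi>, \<tau>)) =
      \<Gamma> * \<bar>\<xi>\<bar> ^ m * exp (- c * ((M * (\<xi> - K))\<^sup>2 + (\<tau> + \<theta>)\<^sup>2))"
  shows "(\<lambda>(\<xi>, \<tau>). (japanese \<xi> powr s * japanese (\<tau> + phase \<alpha> \<beta> \<xi>) powr b *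
      norm (spacetime_fourier u (\<xi>, \<tau>)))\<^sup>2) \<in> borel_measurable borel"
  unfolding assms japanese_def phase_def borel_prod[symmetric] by measurable

text \<open>By \<open>weight_upper\<close> the weight is its central value times powers of the
  rescaled variables; half of the Gaussian absorbs these, and the rest integrates to a multiple of
  N^-4 by dilation. The factor \<open>\<bar>\<xi>\<bar> ^ m\<close>, with m = 1 for an x-derivative,
  is merged into the weight. Integrability is recorded because \<open>Xnorm_lower\<close> compares
  integrals, and a divergent one would count as 0.\<close>

lemma Xnorm_upper:
  assumes "c > 0"
  shows "\<exists>A>0. \<forall>N K \<Gamma> u. N \<ge> 1 \<longrightarrow> \<bar>K\<bar> \<le> N \<longrightarrow> \<Gamma> \<ge> 0 \<longrightarrow>
     (\<forall>\<xi> \<tau>. norm (spacetime_fourier u (\<xi>, \<tau>)) =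
       \<Gamma> * \<bar>\<xi>\<bar> ^ m * exp (- c * ((N ^ 4 * (\<xi> - K))\<^sup>2 + (\<tau> + phase \<alpha> \<beta> K)\<^sup>2))) \<longrightarrow>
     integrable lborel (\<lambda>(\<xi>, \<tau>). (japanese \<xi> powr s * japanese (\<tau> + phase \<alpha> \<beta> \<xi>) powr b *
       norm (spacetime_fourier u (\<xi>, \<tau>)))\<^sup>2) \<and>
     (Xnorm \<alpha> \<beta> s b u)\<^sup>2 \<le> A * (\<Gamma> * japanese K powr (s + m))\<^sup>2 / N ^ 4"
proof -
  obtain A p where A: "A > 0" "p \<ge> 0" and w: "\<And>N K \<xi> \<tau>. N \<ge> 1 \<Longrightarrow> \<bar>K\<bar> \<le> N \<Longrightarrow>
     japanese \<xi> powr (s + m) * japanese (\<tau> + phase \<alpha> \<beta> \<xi>) powr b \<le> A * japanese K powr (s + m) *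
       (japanese (N ^ 4 * (\<xi> - K)) powr p * japanese (\<tau> + phase \<alpha> \<beta> K) powr p)"
    using weight_upper[of "s + m" \<alpha> \<beta> b] by blast
  obtain B where B: "B > 0" "\<And>y. japanese y powr p \<le> B * exp (c / 2 * y\<^sup>2)"
    using japanese_powr_le_exp[of p "c / 2"] A assms by auto
  \<comment> \<open>The Gaussian profile that is left in each variable after half of the exponent
    has been spent and the integrand squared.\<close>
  define g where "g = (\<lambda>y::real. exp (- (c * y\<^sup>2)))"
  define I where "I = (LINT y|lborel. g y)"
  have g: "integrable lborel g" unfolding g_def using assms by (rule integrable_gaussian)
  have I: "I \<ge> 0" unfolding I_def g_def by (intro Bochner_Integration.integral_nonneg) auto
  \<comment> \<open>The summand 1 makes \<open>A'\<close> positive from \<open>I \<ge> 0\<close>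
    alone.\<close>
  define A' where "A' = (A * B\<^sup>2)\<^sup>2 * (I\<^sup>2 + 1)"
  have "integrable lborel (\<lambda>(\<xi>, \<tau>). (japanese \<xi> powr s * japanese (\<tau> + phase \<alpha> \<beta> \<xi>) powr b *
       norm (spacetime_fourier u (\<xi>, \<tau>)))\<^sup>2) \<and>
     (Xnorm \<alpha> \<beta> s b u)\<^sup>2 \<le> A' * (\<Gamma> * japanese K powr (s + m))\<^sup>2 / N ^ 4"
    if N: "N \<ge> 1" "\<bar>K\<bar> \<le> N" "\<Gamma> \<ge> 0" and F: "\<And>\<xi> \<tau>. norm (spacetime_fourier u (\<xi>, \<tau>)) =
       \<Gamma> * \<bar>\<xi>\<bar> ^ m * exp (- c * ((N ^ 4 * (\<xi> - K))\<^sup>2 + (\<tau> + phase \<alpha> \<beta> K)\<^sup>2))"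
    for N K \<Gamma> u
  proof -
    let ?w = "\<lambda>(\<xi>, \<tau>). (japanese \<xi> powr s * japanese (\<tau> + phase \<alpha> \<beta> \<xi>) powr b *
       norm (spacetime_fourier u (\<xi>, \<tau>)))\<^sup>2"
    define R where "R = (A * B\<^sup>2)\<^sup>2 * (\<Gamma> * japanese K powr (s + m))\<^sup>2"
    \<comment> \<open>The second argument is written as a dilation by 1 about - \<phi>(K), so that
      \<open>integral_dilate\<close> covers both variables.\<close>
    define G where "G = (\<lambda>(\<xi>, \<tau>). g (N ^ 4 * (\<xi> - K)) * g (1 * (\<tau> - - phase \<alpha> \<beta> K)))"
    have N4: "N ^ 4 > 0" using N by simp
    have G: "integrable lborel G" "integral\<^sup>L lborel G = I\<^sup>2 / N ^ 4"
      unfolding G_def using integrable_tensor[OF integral_dilate(1)[OF g N4, of K]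
          integral_dilate(1)[OF g zero_less_one, of "- phase \<alpha> \<beta> K"]]
        integral_dilate(2)[OF g N4, of K] integral_dilate(2)[OF g zero_less_one, of "- phase \<alpha> \<beta> K"]
      by (auto simp: I_def power2_eq_square)
    have le: "?w z \<le> R * G z" for z
    proof -
      obtain \<xi> \<tau> where z: "z = (\<xi>, \<tau>)" by fastforce
      define \<eta> where "\<eta> = N ^ 4 * (\<xi> - K)"
      define \<theta> where "\<theta> = \<tau> + phase \<alpha> \<beta> K"
      have "japanese \<xi> powr s * japanese (\<tau> + phase \<alpha> \<beta> \<xi>) powr b * norm (spacetime_fourier u (\<xi>, \<tau>)) =
        japanese \<xi> powr s * \<bar>\<xi>\<bar> ^ m * (japanese (\<tau> + phase \<alpha> \<beta> \<xi>) powr b) *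
        (\<Gamma> * exp (- c * (\<eta>\<^sup>2 + \<theta>\<^sup>2)))" unfolding F \<eta>_def \<theta>_def by simp
      also have "\<dots> \<le> japanese \<xi> powr s * japanese \<xi> ^ m * (japanese (\<tau> + phase \<alpha> \<beta> \<xi>) powr b) *
        (\<Gamma> * exp (- c * (\<eta>\<^sup>2 + \<theta>\<^sup>2)))"
        using N by (intro mult_right_mono mult_left_mono power_mono abs_le_japanese) auto
      also have "\<dots> = (japanese \<xi> powr (s + m) * japanese (\<tau> + phase \<alpha> \<beta> \<xi>) powr b) *
        (\<Gamma> * exp (- c * (\<eta>\<^sup>2 + \<theta>\<^sup>2)))"
        using japanese_pos[of \<xi>] by (simp add: powr_add powr_realpow)
      also have "\<dots> \<le> (A * japanese K powr (s + m) * (japanese \<eta> powr p * japanese \<theta> powr p)) *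
        (\<Gamma> * exp (- c * (\<eta>\<^sup>2 + \<theta>\<^sup>2)))"
        unfolding \<eta>_def \<theta>_def using N by (intro mult_right_mono w) auto
      also have "\<dots> \<le> (A * japanese K powr (s + m) * ((B * exp (c / 2 * \<eta>\<^sup>2)) * (B * exp (c / 2 * \<theta>\<^sup>2)))) *
        (\<Gamma> * exp (- c * (\<eta>\<^sup>2 + \<theta>\<^sup>2)))"
        using N A B by (intro mult_right_mono mult_left_mono mult_mono) auto
      also have "\<dots> = A * B\<^sup>2 * (\<Gamma> * japanese K powr (s + m)) *
          exp (- (c / 2 * \<eta>\<^sup>2) - c / 2 * \<theta>\<^sup>2)"
        by (simp add: power2_eq_square algebra_simps flip: exp_add)
      finally have "?w z \<le> (A * B\<^sup>2 * (\<Gamma> * japanese K powr (s + m)) *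
          exp (- (c / 2 * \<eta>\<^sup>2) - c / 2 * \<theta>\<^sup>2))\<^sup>2"
        unfolding z prod.case by (rule power_mono) auto
      also have "\<dots> = R * (exp (- (c / 2 * \<eta>\<^sup>2) - c / 2 * \<theta>\<^sup>2))\<^sup>2"
        by (simp only: R_def power_mult_distrib)
      also have "(exp (- (c / 2 * \<eta>\<^sup>2) - c / 2 * \<theta>\<^sup>2))\<^sup>2 = G z"
        by (simp add: G_def g_def z \<eta>_def \<theta>_def flip: exp_add exp_double)
      finally show ?thesis .
    qed
    have int: "integrable lborel ?w"
    proof (rule Bochner_Integration.integrable_bound)
      show "integrable lborel (\<lambda>z. R * G z)" using G by simp
      show "?w \<in> borel_measurable lborel" using Xnorm_integrand_measurable[OF F] by simp
      show "AE z in lborel. norm (?w z) \<le> norm (R * G z)"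
        using le by (intro always_eventually allI) (smt (verit, best) real_norm_def case_prod_unfold zero_le_power2)
    qed
    have "(Xnorm \<alpha> \<beta> s b u)\<^sup>2 = integral\<^sup>L lborel ?w"
      unfolding Xnorm_def by (subst real_sqrt_pow2) (auto intro!: Bochner_Integration.integral_nonneg)
    also have "\<dots> \<le> (LINT z|lborel. R * G z)"
      using int G le by (intro integral_mono) auto
    also have "\<dots> = R * I\<^sup>2 / N ^ 4" using G by simp
    also have "\<dots> \<le> A' * (\<Gamma> * japanese K powr (s + m))\<^sup>2 / N ^ 4"
      using N by (intro divide_right_mono) (auto simp: R_def A'_def algebra_simps)
    finally show ?thesis using int by blast
  qed
  moreover have "A' > 0" using A B by (auto simp: A'_def intro!: mult_pos_pos add_nonneg_pos)
  ultimately show ?thesis by blast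
qed

text \<open>Only the box where both rescaled variables are at most 1 in absolute value is kept. It
  has area 4 / N^4, and on it the weight, the Gaussian and \<open>\<bar>\<xi>\<bar> ^ m\<close> are
  bounded below by fixed multiples of their central values.\<close>

lemma Xnorm_lower:
  assumes "c > 0"
  shows "\<exists>a>0. \<forall>N \<Gamma> u. N \<ge> 2 \<longrightarrow> \<Gamma> \<ge> 0 \<longrightarrow>
     (\<forall>\<xi> \<tau>. norm (spacetime_fourier u (\<xi>, \<tau>)) =
       \<Gamma> * \<bar>\<xi>\<bar> ^ m * exp (- c * ((N ^ 4 * (\<xi> - N))\<^sup>2 + (\<tau> + phase \<alpha> \<beta> N)\<^sup>2))) \<longrightarrow>
     a * (\<Gamma> * japanese N powr s * N ^ m)\<^sup>2 / N ^ 4 \<le> (Xnorm \<alpha> \<beta> s b u)\<^sup>2"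
proof -
  obtain A p where A: "A > 0" "p \<ge> 0" and w: "\<And>N K \<xi> \<tau>. N \<ge> 1 \<Longrightarrow> \<bar>K\<bar> \<le> N \<Longrightarrow>
     japanese K powr s \<le> A * (japanese (N ^ 4 * (\<xi> - K)) powr p * japanese (\<tau> + phase \<alpha> \<beta> K) powr p) *
       (japanese \<xi> powr s * japanese (\<tau> + phase \<alpha> \<beta> \<xi>) powr b)"
    using weight_lower[of s \<alpha> \<beta> b] by blast
  have up: "\<And>N K \<Gamma> u. N \<ge> 1 \<Longrightarrow> \<bar>K\<bar> \<le> N \<Longrightarrow> \<Gamma> \<ge> 0 \<Longrightarrow>
     (\<forall>\<xi> \<tau>. norm (spacetime_fourier u (\<xi>, \<tau>)) =
       \<Gamma> * \<bar>\<xi>\<bar> ^ m * exp (- c * ((N ^ 4 * (\<xi> - K))\<^sup>2 + (\<tau> + phase \<alpha> \<beta> K)\<^sup>2))) \<Longrightarrow>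
     integrable lborel (\<lambda>(\<xi>, \<tau>). (japanese \<xi> powr s * japanese (\<tau> + phase \<alpha> \<beta> \<xi>) powr b *
       norm (spacetime_fourier u (\<xi>, \<tau>)))\<^sup>2)"
    using Xnorm_upper[OF assms, of m \<alpha> \<beta> s b] by blast
  define g where "g = (indicator {-1..1} :: real \<Rightarrow> real)"
  have g: "integrable lborel g" "(LINT y|lborel. g y) = 2"
    unfolding g_def by auto
  \<comment> \<open>The losses on the box: \<open>A\<close> from \<open>weight_lower\<close>,
    \<open>2 powr p\<close> for each rescaled variable, \<open>exp (2 * c)\<close> for the Gaussian,
    and \<open>2 ^ m\<close> from |\<xi>| >= N / 2.\<close>
  define Q where "Q = A * (2 powr p * 2 powr p) * exp (2 * c) * 2 ^ m"
  have Q: "Q > 0" using A by (simp add: Q_def)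
  have "(4 / Q\<^sup>2) * (\<Gamma> * japanese N powr s * N ^ m)\<^sup>2 / N ^ 4 \<le> (Xnorm \<alpha> \<beta> s b u)\<^sup>2"
    if N: "N \<ge> 2" "\<Gamma> \<ge> 0" and F: "\<And>\<xi> \<tau>. norm (spacetime_fourier u (\<xi>, \<tau>)) =
       \<Gamma> * \<bar>\<xi>\<bar> ^ m * exp (- c * ((N ^ 4 * (\<xi> - N))\<^sup>2 + (\<tau> + phase \<alpha> \<beta> N)\<^sup>2))"
    for N \<Gamma> u
  proof -
    let ?w = "\<lambda>(\<xi>, \<tau>). (japanese \<xi> powr s * japanese (\<tau> + phase \<alpha> \<beta> \<xi>) powr b *
       norm (spacetime_fourier u (\<xi>, \<tau>)))\<^sup>2"
    define S where "S = \<Gamma> * japanese N powr s * N ^ m"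
    define G where "G = (\<lambda>(\<xi>, \<tau>). g (N ^ 4 * (\<xi> - N)) * g (1 * (\<tau> - - phase \<alpha> \<beta> N)))"
    have N4: "N ^ 4 > 0" using N by simp
    have G: "integrable lborel G" "integral\<^sup>L lborel G = 4 / N ^ 4"
      unfolding G_def using integrable_tensor[OF integral_dilate(1)[OF g(1) N4, of N]
          integral_dilate(1)[OF g(1) zero_less_one, of "- phase \<alpha> \<beta> N"]]
        integral_dilate(2)[OF g(1) N4, of N] integral_dilate(2)[OF g(1) zero_less_one, of "- phase \<alpha> \<beta> N"]
      by (auto simp: g(2))
    have le: "(S / Q)\<^sup>2 * G z \<le> ?w z" for z
    proof (cases "G z = 0")
      case True
      thus ?thesis by (auto simp: case_prod_unfold)
    next
      case False
      obtain \<xi> \<tau> where z: "z = (\<xi>, \<tau>)" by fastforce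
      define \<eta> where "\<eta> = N ^ 4 * (\<xi> - N)"
      define \<theta> where "\<theta> = \<tau> + phase \<alpha> \<beta> N"
      have G1: "G z = 1" and \<eta>: "\<bar>\<eta>\<bar> \<le> 1" and \<theta>: "\<bar>\<theta>\<bar> \<le> 1"
        using False by (auto simp: G_def z g_def \<eta>_def \<theta>_def indicator_def split: if_splits)
      have "\<bar>\<xi> - N\<bar> \<le> N ^ 4 * \<bar>\<xi> - N\<bar>"
        using N by (simp add: mult_le_cancel_right1)
      also have "\<dots> = \<bar>\<eta>\<bar>" using N by (simp add: \<eta>_def abs_mult)
      \<comment> \<open>Here N >= 2 enters: |\<xi> - N| <= 1 <= N / 2.\<close>
      finally have "N \<le> 2 * \<bar>\<xi>\<bar>" using \<eta> N by linarith
      hence "N ^ m \<le> (2 * \<bar>\<xi>\<bar>) ^ m" using N by (intro power_mono) auto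
      hence \<xi>: "N ^ m \<le> 2 ^ m * \<bar>\<xi>\<bar> ^ m" by (simp add: power_mult_distrib)
      have J: "japanese y powr p \<le> 2 powr p" if "\<bar>y\<bar> \<le> 1" for y
        using that japanese_le[of y] A japanese_pos[of y] by (intro powr_mono2) auto
      have "\<eta>\<^sup>2 \<le> 1" "\<theta>\<^sup>2 \<le> 1" using \<eta> \<theta> by (simp_all add: abs_square_le_1)
      hence "c * (\<eta>\<^sup>2 + \<theta>\<^sup>2) \<le> c * 2" using assms by (intro mult_left_mono) auto
      hence e: "1 \<le> exp (2 * c) * exp (- c * (\<eta>\<^sup>2 + \<theta>\<^sup>2))"
        by (simp flip: exp_add)
      define W where "W = japanese \<xi> powr s * japanese (\<tau> + phase \<alpha> \<beta> \<xi>) powr b"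
      have W: "W \<ge> 0" by (simp add: W_def)
      have "japanese N powr s \<le> A * (japanese \<eta> powr p * japanese \<theta> powr p) * W"
        using w[of N N \<xi> \<tau>] N by (simp add: \<eta>_def \<theta>_def W_def)
      also have "\<dots> \<le> A * (2 powr p * 2 powr p) * W"
        using A W \<eta> \<theta> J by (intro mult_right_mono mult_left_mono mult_mono) auto
      finally have "S \<le> \<Gamma> * (A * (2 powr p * 2 powr p) * W) * (2 ^ m * \<bar>\<xi>\<bar> ^ m)"
        unfolding S_def using N \<xi> A W by (intro mult_mono mult_left_mono) auto
      also have "\<dots> = \<Gamma> * (A * (2 powr p * 2 powr p) * W) * (2 ^ m * \<bar>\<xi>\<bar> ^ m) * 1" by simp
      also have "\<dots> \<le> \<Gamma> * (A * (2 powr p * 2 powr p) * W) * (2 ^ m * \<bar>\<xi>\<bar> ^ m) *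
         (exp (2 * c) * exp (- c * (\<eta>\<^sup>2 + \<theta>\<^sup>2)))"
        using N A W by (intro mult_left_mono e) auto
      also have "\<dots> = Q * (W * norm (spacetime_fourier u (\<xi>, \<tau>)))"
        unfolding F Q_def \<eta>_def \<theta>_def by (simp add: mult_ac)
      finally have "S / Q \<le> W * norm (spacetime_fourier u (\<xi>, \<tau>))"
        using Q by (simp add: field_simps)
      moreover have "0 \<le> S / Q" using Q N by (simp add: S_def)
      ultimately have "(S / Q)\<^sup>2 \<le> (W * norm (spacetime_fourier u (\<xi>, \<tau>)))\<^sup>2"
        by (intro power_mono)
      thus ?thesis
        unfolding z prod.case W_def using G1[unfolded z] by simp
    qed
    have "4 / Q\<^sup>2 * S\<^sup>2 / N ^ 4 = (LINT z|lborel. (S / Q)\<^sup>2 * G z)"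
      using G by (simp add: power_divide mult_ac)
    also have "\<dots> \<le> integral\<^sup>L lborel ?w"
      using up[of N N \<Gamma> u] F N G le by (intro integral_mono) auto
    also have "\<dots> = (Xnorm \<alpha> \<beta> s b u)\<^sup>2"
      unfolding Xnorm_def by (subst real_sqrt_pow2) (auto intro!: Bochner_Integration.integral_nonneg)
    finally show ?thesis by (simp add: S_def)
  qed
  moreover have "4 / Q\<^sup>2 > 0" using Q by simp
  ultimately show ?thesis by blast
qed

subsection \<open>Wave packets\<close>

lemma fourier_pgauss_1:
  assumes "a > 0"
  shows "(LINT x|lborel. exp (- \<i> * of_real (x * \<xi>)) * pgauss 1 a k x) =
    of_real (sqrt (pi / a) * exp (- ((\<xi> - k)\<^sup>2 / (4 * a))))"
  unfolding modulate_pgauss using integral_pgauss_1[OF assms] by (simp add: power2_commute)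

text \<open>The Gaussian rate a / M^2 in x gives frequency width of order 1 / M. The amplitude is
  sqrt (pi M^2 / a) sqrt (pi / a) / (2 pi) = M / (2 a). The parameter a is 1 / 2 for the two factors
  and 1 for their product.\<close>

lemma norm_fourier_packet:
  assumes "a > 0" "M > 0"
  shows "norm (spacetime_fourier (\<lambda>(x, t). pgauss 1 (a / M\<^sup>2) K x * pgauss 1 a L t) (\<xi>, \<tau>)) =
      M / (2 * a) * exp (- (1 / (4 * a)) * ((M * (\<xi> - K))\<^sup>2 + (\<tau> - L)\<^sup>2))" (is ?thesis1)
    and "norm (spacetime_fourier
        (partial_x (\<lambda>(x, t). pgauss 1 (a / M\<^sup>2) K x * pgauss 1 a L t)) (\<xi>, \<tau>)) =
      M / (2 * a) * \<bar>\<xi>\<bar> * exp (- (1 / (4 * a)) * ((M * (\<xi> - K))\<^sup>2 + (\<tau> - L)\<^sup>2))" (is ?thesis2)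
proof -
  have a: "a / M\<^sup>2 > 0" using assms by simp
  have "sqrt (pi / (a / M\<^sup>2)) * sqrt (pi / a) = pi * M / a"
    using assms by (simp add: real_sqrt_divide real_sqrt_mult)
  moreover have "exp (- ((\<xi> - K)\<^sup>2 / (4 * (a / M\<^sup>2)))) * exp (- ((\<tau> - L)\<^sup>2 / (4 * a))) =
    exp (- (1 / (4 * a)) * ((M * (\<xi> - K))\<^sup>2 + (\<tau> - L)\<^sup>2))"
  proof -
    have "- (X / (4 * (a / M\<^sup>2))) + - (Y / (4 * a)) = - (1 / (4 * a)) * (M\<^sup>2 * X + Y)" for X Y
      using assms by (simp add: field_simps)
    thus ?thesis by (simp only: power_mult_distrib flip: exp_add)
  qed
  \<comment> \<open>Amplitudes are grouped with amplitudes and exponentials with exponentials, so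
    that the two products just computed can be substituted.\<close>
  moreover have "1 / (2 * pi) * ((p * e) * (q * f)) = 1 / (2 * pi) * (p * q) * (e * f)" for p q e f :: real
    by simp
  ultimately have *: "1 / (2 * pi) * ((sqrt (pi / (a / M\<^sup>2)) * exp (- ((\<xi> - K)\<^sup>2 / (4 * (a / M\<^sup>2))))) *
      (sqrt (pi / a) * exp (- ((\<tau> - L)\<^sup>2 / (4 * a))))) =
    M / (2 * a) * exp (- (1 / (4 * a)) * ((M * (\<xi> - K))\<^sup>2 + (\<tau> - L)\<^sup>2))"
    by (simp only:) simp
  show ?thesis1
    unfolding spacetime_fourier_tensor[OF integrable_pgauss[OF a] integrable_pgauss[OF assms(1)]]
      fourier_pgauss_1[OF a] fourier_pgauss_1[OF assms(1)] norm_mult norm_of_real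
    unfolding *[symmetric] using assms by (simp add: abs_mult)
  show ?thesis2
    unfolding partial_x_pgauss
      spacetime_fourier_tensor[OF integrable_pgauss[OF a] integrable_pgauss[OF assms(1)]]
      fourier_pgauss_pderiv[OF a]
      fourier_pgauss_1[OF a] fourier_pgauss_1[OF assms(1)] norm_mult norm_of_real
    \<comment> \<open>Moving \<open>\<bar>\<xi>\<bar>\<close> to the front exposes the right-hand
      side of \<open>*\<close>, which is then folded back.\<close>
    unfolding mult.assoc mult.left_commute[of _ "\<bar>\<xi>\<bar>"]
    unfolding *[symmetric, unfolded mult.assoc] using assms by (simp add: abs_mult)
qed

section \<open>Failure of the bilinear estimate for large N\<close>

theorem theorem1p3:
  fixes \<alpha> \<beta> \<epsilon> s s\<^sub>1 b' b :: real
  assumes "\<alpha> \<noteq> 0"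
    and "\<epsilon> > 0"
    and "s \<le> - 1 / 2"
    and "s\<^sub>1 = 1 / 2 + 2 * \<epsilon>"
    and "b' = - 1 / 2 + 2 * \<epsilon>"
    and "b = 1 / 2 + \<epsilon> / 2"
  shows "\<not> (\<exists>C>0. \<forall>u v. schwartz u \<longrightarrow> schwartz v \<longrightarrow>
           Xnorm \<alpha> \<beta> s\<^sub>1 b' (partial_x (\<lambda>p. u p * v p))
             \<le> C * Xnorm \<alpha> \<beta> s b u * Xnorm \<alpha> \<beta> s b v)"
proof
  assume "\<exists>C>0. \<forall>u v. schwartz u \<longrightarrow> schwartz v \<longrightarrow>
           Xnorm \<alpha> \<beta> s\<^sub>1 b' (partial_x (\<lambda>p. u p * v p))
             \<le> C * Xnorm \<alpha> \<beta> s b u * Xnorm \<alpha> \<beta> s b v"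
  then obtain C where C: "C > 0" "\<And>u v. schwartz u \<Longrightarrow> schwartz v \<Longrightarrow>
           Xnorm \<alpha> \<beta> s\<^sub>1 b' (partial_x (\<lambda>p. u p * v p))
             \<le> C * Xnorm \<alpha> \<beta> s b u * Xnorm \<alpha> \<beta> s b v" by blast
  \<comment> \<open>The decay rates 1 / 2 here and 1 / 4 below are 1 / (4 a) for a = 1 / 2 (the
    factors) and a = 1 (the product). \<open>A\<close> and \<open>a\<close> are fixed before
    N.\<close>
  obtain A where A: "A > 0" and upper: "\<And>N K \<Gamma> u. N \<ge> 1 \<Longrightarrow> \<bar>K\<bar> \<le> N \<Longrightarrow> \<Gamma> \<ge> 0 \<Longrightarrow>
     (\<And>\<xi> \<tau>. norm (spacetime_fourier u (\<xi>, \<tau>)) =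
       \<Gamma> * exp (- (1 / 2) * ((N ^ 4 * (\<xi> - K))\<^sup>2 + (\<tau> + phase \<alpha> \<beta> K)\<^sup>2))) \<Longrightarrow>
     (Xnorm \<alpha> \<beta> s b u)\<^sup>2 \<le> A * (\<Gamma> * japanese K powr s)\<^sup>2 / N ^ 4"
    using Xnorm_upper[of "1 / 2" 0 \<alpha> \<beta> s b] by auto
  obtain a where a: "a > 0" and lower: "\<And>N \<Gamma> u. N \<ge> 2 \<Longrightarrow> \<Gamma> \<ge> 0 \<Longrightarrow>
     (\<And>\<xi> \<tau>. norm (spacetime_fourier u (\<xi>, \<tau>)) =
       \<Gamma> * \<bar>\<xi>\<bar> * exp (- (1 / 4) * ((N ^ 4 * (\<xi> - N))\<^sup>2 + (\<tau> + phase \<alpha> \<beta> N)\<^sup>2))) \<Longrightarrow>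
     a * (\<Gamma> * japanese N powr s\<^sub>1 * N)\<^sup>2 / N ^ 4 \<le> (Xnorm \<alpha> \<beta> s\<^sub>1 b' u)\<^sup>2"
    using Xnorm_lower[of "1 / 4" 1 \<alpha> \<beta> s\<^sub>1 b'] by auto
  have bound: "N powr (4 * \<epsilon>) \<le> 4 * C\<^sup>2 * A\<^sup>2 / a" if N: "N \<ge> 2" for N
  proof -
    define M where "M = N ^ 4"
    have M: "M > 0" using N by (simp add: M_def)
    define w where "w = (\<lambda>K (x, t). pgauss 1 ((1 / 2) / M\<^sup>2) K x * pgauss 1 (1 / 2) (- phase \<alpha> \<beta> K) t)"
    have schwartz: "schwartz (w K)" for K
      unfolding w_def using M by (intro schwartz_pgauss) auto
    have norm_w: "(Xnorm \<alpha> \<beta> s b (w K))\<^sup>2 \<le> A * (M * japanese K powr s)\<^sup>2 / M" if "\<bar>K\<bar> \<le> N" for K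
      unfolding M_def
    proof (rule upper)
      show "norm (spacetime_fourier (w K) (\<xi>, \<tau>)) =
        N ^ 4 * exp (- (1 / 2) * ((N ^ 4 * (\<xi> - K))\<^sup>2 + (\<tau> + phase \<alpha> \<beta> K)\<^sup>2))" for \<xi> \<tau>
        using norm_fourier_packet(1)[OF _ M, of "1 / 2" K "- phase \<alpha> \<beta> K"] by (simp add: w_def M_def)
    qed (use N that in auto)
    \<comment> \<open>Gaussian rates and frequencies add. Since \<phi>(0) = 0, the product is again
      centred at (N, - \<phi>(N)) on the dispersion curve.\<close>
    have prod: "(\<lambda>p. w 0 p * w N p) =
        (\<lambda>(x, t). pgauss 1 (1 / M\<^sup>2) N x * pgauss 1 1 (- phase \<alpha> \<beta> N) t)"
    proof (intro ext, clarify)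
      fix x t
      have "w 0 (x, t) * w N (x, t) =
        (pgauss 1 ((1 / 2) / M\<^sup>2) 0 x * pgauss 1 ((1 / 2) / M\<^sup>2) N x) *
        (pgauss 1 (1 / 2) (- phase \<alpha> \<beta> 0) t * pgauss 1 (1 / 2) (- phase \<alpha> \<beta> N) t)"
        by (simp add: w_def)
      also have "\<dots> = pgauss 1 (1 / M\<^sup>2) N x * pgauss 1 1 (- phase \<alpha> \<beta> N) t"
        unfolding pgauss_mult by (simp add: phase_def)
      finally show "w 0 (x, t) * w N (x, t) = pgauss 1 (1 / M\<^sup>2) N x * pgauss 1 1 (- phase \<alpha> \<beta> N) t" .
    qed
    have "a * (M / 2 * japanese N powr s\<^sub>1 * N)\<^sup>2 / M \<le>
        (Xnorm \<alpha> \<beta> s\<^sub>1 b' (partial_x (\<lambda>p. w 0 p * w N p)))\<^sup>2"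
      unfolding M_def
    proof (rule lower)
      show "norm (spacetime_fourier (partial_x (\<lambda>p. w 0 p * w N p)) (\<xi>, \<tau>)) =
        N ^ 4 / 2 * \<bar>\<xi>\<bar> * exp (- (1 / 4) * ((N ^ 4 * (\<xi> - N))\<^sup>2 + (\<tau> + phase \<alpha> \<beta> N)\<^sup>2))" for \<xi> \<tau>
        unfolding prod using norm_fourier_packet(2)[OF _ M, of 1 N "- phase \<alpha> \<beta> N"] by (simp add: M_def)
    qed (use N in auto)
    also have "\<dots> \<le> (C * Xnorm \<alpha> \<beta> s b (w 0) * Xnorm \<alpha> \<beta> s b (w N))\<^sup>2"
      by (intro power_mono C schwartz) (auto simp: Xnorm_def intro!: Bochner_Integration.integral_nonneg)
    also have "\<dots> = C\<^sup>2 * ((Xnorm \<alpha> \<beta> s b (w 0))\<^sup>2 * (Xnorm \<alpha> \<beta> s b (w N))\<^sup>2)"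
      by (simp add: power_mult_distrib)
    also have "\<dots> \<le> C\<^sup>2 * ((A * (M * japanese 0 powr s)\<^sup>2 / M) * (A * (M * japanese N powr s)\<^sup>2 / M))"
      using A M N by (intro mult_left_mono mult_mono norm_w) auto
    \<comment> \<open>The packet at frequency 0 contributes no power of N from its weight, since
      \<open>japanese 0\<close> is 1.\<close>
    also have "\<dots> = C\<^sup>2 * A\<^sup>2 * M\<^sup>2 * (japanese N powr s)\<^sup>2"
      using M by (simp add: japanese_def power2_eq_square)
    also have "a * (M / 2 * japanese N powr s\<^sub>1 * N)\<^sup>2 / M = a / 4 * M * N\<^sup>2 * (japanese N powr s\<^sub>1)\<^sup>2"
      using M by (simp add: power2_eq_square)
    finally have main: "a / 4 * M * N\<^sup>2 * (japanese N powr s\<^sub>1)\<^sup>2 \<le>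
        C\<^sup>2 * A\<^sup>2 * M\<^sup>2 * (japanese N powr s)\<^sup>2" .
    have J: "N \<le> japanese N" using abs_le_japanese[of N] by simp
    have "N powr (1 + 4 * \<epsilon>) = (N powr s\<^sub>1)\<^sup>2"
      using N assms by (simp add: power2_eq_square flip: powr_add)
    also have "\<dots> \<le> (japanese N powr s\<^sub>1)\<^sup>2"
      using N J assms by (intro power_mono powr_mono2) auto
    finally have J1: "N powr (1 + 4 * \<epsilon>) \<le> (japanese N powr s\<^sub>1)\<^sup>2" .
    have "(japanese N powr s)\<^sup>2 = japanese N powr (2 * s)"
      by (simp add: power2_eq_square flip: powr_add)
    also have "\<dots> \<le> japanese N powr (- 1)"
      using N J assms by (intro powr_mono) auto
    also have "\<dots> \<le> N powr (- 1)" using N J by (intro powr_mono2') auto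
    finally have J2: "(japanese N powr s)\<^sup>2 \<le> 1 / N" using N by (simp add: powr_minus_divide)
    \<comment> \<open>The power count: the left side is of order N^(7 + 4 \<epsilon>), the right
      side of order M^2 / N = M N^3 = N^7, so exactly \<open>N powr (4 * \<epsilon>)\<close>
      survives.\<close>
    have "a / 4 * M * N\<^sup>2 * (N * N powr (4 * \<epsilon>)) \<le> a / 4 * M * N\<^sup>2 * (japanese N powr s\<^sub>1)\<^sup>2"
      using J1 a M N by (intro mult_left_mono) (auto simp: powr_add)
    also have "\<dots> \<le> C\<^sup>2 * A\<^sup>2 * M\<^sup>2 * (japanese N powr s)\<^sup>2" by (rule main)
    also have "\<dots> \<le> C\<^sup>2 * A\<^sup>2 * M\<^sup>2 * (1 / N)"
      using J2 by (intro mult_left_mono) auto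
    also have "\<dots> = C\<^sup>2 * A\<^sup>2 * M * N ^ 3"
      using N by (simp add: M_def power2_eq_square power3_eq_cube power4_eq_xxxx)
    finally have "(M * N ^ 3) * (a / 4 * N powr (4 * \<epsilon>)) \<le> (M * N ^ 3) * (C\<^sup>2 * A\<^sup>2)"
      by (simp add: power2_eq_square power3_eq_cube mult_ac)
    hence "a / 4 * N powr (4 * \<epsilon>) \<le> C\<^sup>2 * A\<^sup>2"
      using M N by (subst (asm) mult_le_cancel_left_pos) auto
    thus ?thesis using a by (simp add: field_simps)
  qed
  have "filterlim (\<lambda>N::real. N powr (4 * \<epsilon>)) at_top at_top"
    using assms(2) by real_asymp
  hence "eventually (\<lambda>N. N powr (4 * \<epsilon>) > 4 * C\<^sup>2 * A\<^sup>2 / a) at_top"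
    by (simp add: filterlim_at_top_dense)
  hence "eventually (\<lambda>N::real. False) at_top"
    using eventually_ge_at_top[of 2] by eventually_elim (use bound in fastforce)
  thus False by simp
qed

end
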